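(* Let $R$ be a ring, $n\ge1$, let $\delta:R\to R$ be an endomorphism and let $T=[t_{i,j}]$ be a transitive matrix in $\mathrm{M}_n(\mathrm{Z}(R))$. If $A\in\mathrm{M}_n(R,\delta,T)$, then $$\mathrm{rdet}_{(k)}(A),\ \mathrm{ldet}_{(k)}(A)\in\mathrm{Fix}(\delta)$$ for all $k\ge1$. In particular, $\mathrm{sdet}(A)=\mathrm{rdet}_{(1)}(A)=\mathrm{ldet}_{(1)}(A)\in\mathrm{Fix}(\delta)$.
   Context: A ring means a not necessarily commutative ring with identity; endomorphisms preserve the identity. $\mathrm{Z}(R)$ is the center of $R$, $\mathrm{M}_n(R)$ the ring of $n\times n$ matrices over $R$, and $\mathrm{Fix}(\delta)=\{r\in R\mid\delta(r)=r\}$. A matrix $T=[t_{i,j}]$ is transitive if $t_{i,i}=1$ and $t_{i,j}t_{j,l}=t_{i,l}$ for all $i,j,l\in\{1,\ldots,n\}$. The supermatrix algebra is $$\mathrm{M}_n(R,\delta,T)=\{A=[a_{i,j}]\in\mathrm{M}_n(R)\mid \delta(a_{i,j})=t_{i,j}a_{i,j}\text{ for all }1\le i,j\le n\}.$$ For $A=[a_{i,j}]\in\mathrm{M}_n(R)$, the symmetric determinant is $$\mathrm{sdet}(A)=\sum_{\tau,\pi\in\mathrm{S}_n}\mathrm{sgn}(\pi)\,a_{\tau(1),\pi(\tau(1))}\cdots a_{\tau(n),\pi(\tau(n))},$$ and the preadjoint $A^{\ast}=[a^{\ast}_{r,s}]$ is defined by $$a_{r,s}^{\ast}=\sum_{\tau,\pi}\mathrm{sgn}(\pi)\,a_{\tau(1),\pi(\tau(1))}\cdots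 a_{\tau(s-1),\pi(\tau(s-1))}\,a_{\tau(s+1),\pi(\tau(s+1))}\cdots a_{\tau(n),\pi(\tau(n))},$$ the sum being over all $\tau,\pi\in\mathrm{S}_n$ with $\tau(s)=s$, $\pi(s)=r$ (an empty product is $1$). The right adjoint sequence of $A$ is $P_1=A^{\ast}$, $P_{k+1}=(AP_1\cdots P_k)^{\ast}$ for $k\ge1$, and $\mathrm{rdet}_{(k)}(A)=\mathrm{tr}(AP_1\cdots P_k)$. The left adjoint sequence is $Q_1=A^{\ast}$, $Q_{k+1}=(Q_k\cdots Q_1A)^{\ast}$ for $k\ge1$, and $\mathrm{ldet}_{(k)}(A)=\mathrm{tr}(Q_k\cdots Q_1A)$. Here $\mathrm{tr}$ is the sum of the diagonal entries. *)

theory Defs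
  imports "Jordan_Normal_Form.Matrix" "HOL-Combinatorics.Permutations"
begin

text \<open>
  The sort {ring, monoid_mult} is that of all rings with identity. Unlike ring_1, it does not
  impose 0 \<noteq> 1, so the zero ring is included. The indices 1, ..., n are shifted to 0, ..., n - 1,
  following the convention for the type of matrices.
\<close>

definition ring_center :: "'a::{ring,monoid_mult} set" where
  "ring_center = {z. \<forall>x. z * x = x * z}"

definition ring_endomorphism :: "('a::{ring,monoid_mult} \<Rightarrow> 'a) \<Rightarrow> bool" where
  "ring_endomorphism \<delta> \<longleftrightarrow>
     (\<forall>x y. \<delta> (x + y) = \<delta> x + \<delta> y) \<and> (\<forall>x y. \<delta> (x * y) = \<delta> x * \<delta> y) \<and> \<delta> 1 = 1"

definition Fix :: "('a::{ring,monoid_mult} \<Rightarrow> 'a) \<Rightarrow> 'a set" where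
  "Fix \<delta> = {r. \<delta> r = r}"

definition transitive_mat :: "nat \<Rightarrow> 'a::{ring,monoid_mult} mat \<Rightarrow> bool" where
  "transitive_mat n T \<longleftrightarrow> T \<in> carrier_mat n n \<and>
     (\<forall>i<n. T $$ (i, i) = 1) \<and>
     (\<forall>i<n. \<forall>j<n. \<forall>l<n. T $$ (i, j) * T $$ (j, l) = T $$ (i, l))"

definition supermatrix_algebra ::
  "nat \<Rightarrow> ('a::{ring,monoid_mult} \<Rightarrow> 'a) \<Rightarrow> 'a mat \<Rightarrow> 'a mat set" where
  "supermatrix_algebra n \<delta> T =
     {A \<in> carrier_mat n n. \<forall>i<n. \<forall>j<n. \<delta> (A $$ (i, j)) = T $$ (i, j) * A $$ (i, j)}"

text \<open>
  The library's integer-valued sign of a permutation cannot be embedded by of_int, which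
  needs the class ring_1.
\<close>

definition perm_sgn :: "(nat \<Rightarrow> nat) \<Rightarrow> 'a::{ring,monoid_mult}" where
  "perm_sgn \<pi> = (if sign \<pi> = 1 then 1 else - 1)"

definition sdet :: "'a::{ring,monoid_mult} mat \<Rightarrow> 'a" where
  "sdet A = (let n = dim_row A in
     \<Sum>\<tau> | \<tau> permutes {..<n}. \<Sum>\<pi> | \<pi> permutes {..<n}.
       perm_sgn \<pi> * prod_list (map (\<lambda>i. A $$ (\<tau> i, \<pi> (\<tau> i))) [0..<n]))"

text \<open>The products below run over i = 0, ..., n - 1 in this order, omitting i = s.\<close>

definition preadjoint :: "'a::{ring,monoid_mult} mat \<Rightarrow> 'a mat" where
  "preadjoint A = (let n = dim_row A in
     mat n n (\<lambda>(r, s).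
       \<Sum>\<tau> | \<tau> permutes {..<n} \<and> \<tau> s = s. \<Sum>\<pi> | \<pi> permutes {..<n} \<and> \<pi> s = r.
         perm_sgn \<pi> *
         prod_list (map (\<lambda>i. A $$ (\<tau> i, \<pi> (\<tau> i))) (filter (\<lambda>i. i \<noteq> s) [0..<n]))))"

definition mat_trace :: "'a::{ring,monoid_mult} mat \<Rightarrow> 'a" where
  "mat_trace A = (\<Sum>i<dim_row A. A $$ (i, i))"

text \<open>
  The sequences start at k = 1; the value at k = 0 is irrelevant. A left fold over
  [1..<Suc k], starting with A, builds the products A P(1) ... P(k) and Q(k) ... Q(1) A,
  where P(k) stands for right_adjoint_seq A k and Q(k) for left_adjoint_seq A k.
\<close>

fun right_adjoint_seq :: "'a::{ring,monoid_mult} mat \<Rightarrow> nat \<Rightarrow> 'a mat" where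
  "right_adjoint_seq A k = preadjoint (foldl (\<lambda>M P. M * P) A (map (right_adjoint_seq A) [1..<k]))"

fun left_adjoint_seq :: "'a::{ring,monoid_mult} mat \<Rightarrow> nat \<Rightarrow> 'a mat" where
  "left_adjoint_seq A k = preadjoint (foldl (\<lambda>M Q. Q * M) A (map (left_adjoint_seq A) [1..<k]))"

declare right_adjoint_seq.simps [simp del] left_adjoint_seq.simps [simp del]

definition rdet :: "nat \<Rightarrow> 'a::{ring,monoid_mult} mat \<Rightarrow> 'a" where
  "rdet k A = mat_trace (foldl (\<lambda>M P. M * P) A (map (right_adjoint_seq A) [1..<Suc k]))"

definition ldet :: "nat \<Rightarrow> 'a::{ring,monoid_mult} mat \<Rightarrow> 'a" where
  "ldet k A = mat_trace (foldl (\<lambda>M Q. Q * M) A (map (left_adjoint_seq A) [1..<Suc k]))"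

lemma right_adjoint_seq_1: "right_adjoint_seq A 1 = preadjoint A"
  by (subst right_adjoint_seq.simps) simp

lemma right_adjoint_seq_Suc:
  "right_adjoint_seq A (Suc k) = preadjoint (foldl (\<lambda>M P. M * P) A (map (right_adjoint_seq A) [1..<Suc k]))"
  by (rule right_adjoint_seq.simps)

lemma left_adjoint_seq_1: "left_adjoint_seq A 1 = preadjoint A"
  by (subst left_adjoint_seq.simps) simp

lemma left_adjoint_seq_Suc:
  "left_adjoint_seq A (Suc k) =
     preadjoint (foldl (\<lambda>M Q. Q * M) A (map (left_adjoint_seq A) [1..<Suc k]))"
  by (rule left_adjoint_seq.simps)

end

theory Submission
  imports Defs "HOL-Combinatorics.Multiset_Permutations"
begin

text \<open>
  Entrywise, \<open>\<delta>\<close> multiplies a product of entries \<open>a(i, \<pi> i)\<close> by the corresponding product of central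
  elements \<open>t(i, \<pi> i)\<close>. Since \<open>t(i, j) = t(i, s) t(s, j)\<close>, a product of this kind over all
  indices equals \<open>1\<close>, so over the indices other than \<open>s\<close> it equals \<open>t(\<pi> s, s)\<close>. Hence the
  preadjoint stays in the supermatrix algebra, and so do all products of the adjoint sequences;
  their diagonal entries are fixed by \<open>\<delta>\<close> because \<open>t(i, i) = 1\<close>. For the symmetric determinant,
  an ordering of the indices is a first (or last) index followed (or preceded) by an ordering of
  the others, which is how the diagonal entries of \<open>A A\<^sup>*\<close> and \<open>A\<^sup>* A\<close> arise.
\<close>

section \<open>Products of lists with central entries\<close>

lemma mult_in_ring_center:
  "x \<in> ring_center \<Longrightarrow> y \<in> ring_center \<Longrightarrow> x * y \<in> ring_center"
  unfolding ring_center_def mem_Collect_eq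
proof
  fix z assume x: "\<forall>z. x * z = z * x" and y: "\<forall>z. y * z = z * y"
  have "x * y * z = x * (z * y)" using y by (simp add: mult.assoc)
  also have "\<dots> = x * z * y" by (simp add: mult.assoc)
  also have "x * z = z * x" using x by blast
  finally show "x * y * z = z * (x * y)" by (simp add: mult.assoc)
qed

lemma prod_list_in_ring_center:
  "set xs \<subseteq> ring_center \<Longrightarrow> prod_list xs \<in> ring_center"
proof (induction xs)
  case Nil
  show ?case by (simp add: ring_center_def)
next
  case (Cons x xs)
  then show ?case by (simp add: mult_in_ring_center)
qed

lemma ring_center_commute: "x \<in> ring_center \<Longrightarrow> x * y = y * x"
  unfolding ring_center_def by blast

text \<open>Each central \<open>f i\<close> moves left past the preceding \<open>g j\<close>; the
  \<open>g j\<close> keep their order, which matters because they need not commute.\<close>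

lemma prod_list_mult_central:
  assumes "\<And>i. i \<in> set xs \<Longrightarrow> f i \<in> ring_center"
  shows "prod_list (map (\<lambda>i. f i * g i) xs) = prod_list (map f xs) * prod_list (map g xs)"
  using assms
proof (induction xs)
  case (Cons a xs)
  have "prod_list (map f xs) \<in> ring_center"
    using Cons.prems by (intro prod_list_in_ring_center) auto
  then have "g a * prod_list (map f xs) = prod_list (map f xs) * g a"
    by (simp add: ring_center_commute)
  with Cons show ?case
    by simp (metis mult.assoc)
qed simp

text \<open>Left multiplications by central elements commute as functions, so a fold of them depends
  only on the multiset of the list.\<close>

lemma prod_list_central_permute:
  assumes "mset xs = mset ys" and "set xs \<subseteq> ring_center"
  shows "prod_list xs = prod_list ys"
proof -
  have "fold (*) xs = fold (*) ys"
  proof (rule fold_multiset_equiv)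
    fix x y assume "x \<in> set xs" "y \<in> set xs"
    then show "(*) x \<circ> (*) y = (*) y \<circ> (*) x"
      using assms(2) by (auto simp: fun_eq_iff mult.assoc[symmetric] ring_center_commute)
  qed (use assms in auto)
  \<comment> \<open>\<open>fold\<close> applies the head of the list first and so builds the product
    in reverse order; centrality undoes the reversal.\<close>
  moreover have "prod_list zs = fold (*) zs 1" if "set zs \<subseteq> ring_center" for zs :: "'a list"
  proof -
    have "fold (*) zs a = prod_list zs * a" for a
      using that
    proof (induction zs arbitrary: a)
      case (Cons z zs)
      then have "fold (*) (z # zs) a = prod_list zs * z * a" by (simp add: mult.assoc)
      also have "prod_list zs * z = z * prod_list zs"
        using Cons.prems ring_center_commute[of z "prod_list zs"] by simp
      finally show ?case by simp
    qed simp
    then show ?thesis by simp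
  qed
  moreover have "set ys = set xs" using assms(1) by (metis set_mset_mset)
  ultimately show ?thesis using assms(2) by metis
qed

section \<open>Products of entries of a transitive matrix along a permutation\<close>

lemma transitive_mat_entry_central:
  assumes "transitive_mat n T" and "elements_mat T \<subseteq> ring_center" and "i < n" and "j < n"
  shows "T $$ (i, j) \<in> ring_center"
proof -
  have "T \<in> carrier_mat n n" using assms(1) by (simp add: transitive_mat_def)
  from elements_matI[OF this assms(3,4) refl] show ?thesis using assms(2) by blast
qed

text \<open>Factoring every entry through one base index separates rows from columns. The
  permutation only rearranges the central column factors, so it may be replaced by the identity,
  which leaves a product of diagonal entries.\<close>

lemma transitive_mat_prod_permutation:
  assumes T: "transitive_mat n T" and cen: "elements_mat T \<subseteq> ring_center"
    and xs: "xs \<in> permutations_of_set {..<n}" and \<pi>: "\<pi> permutes {..<n}"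
  shows "prod_list (map (\<lambda>i. T $$ (i, \<pi> i)) xs) = 1"
proof (cases "n = 0")
  case True
  with xs show ?thesis by (simp add: permutations_of_set_def)
next
  case False
  note c = transitive_mat_entry_central[OF T cen]
  have set: "set xs = {..<n}" "distinct xs" using xs by (auto simp: permutations_of_set_def)
  \<comment> \<open>Index 0 is the base point; it is a valid index only for \<open>n > 0\<close>,
    hence the case split.\<close>
  have tr: "T $$ (i, 0) * T $$ (0, j) = T $$ (i, j)" if "i < n" "j < n" for i j
    using T False that by (auto simp: transitive_mat_def)
  have \<pi>_less: "\<pi> i < n" if "i < n" for i
    using permutes_in_image[OF \<pi>, of i] that by simp
  \<comment> \<open>Stated for arbitrary \<open>\<sigma>\<close> in order to compare
    \<open>\<pi>\<close> with the identity.\<close>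
  have mult: "prod_list (map (\<lambda>i. T $$ (i, \<sigma> i)) xs) =
      prod_list (map (\<lambda>i. T $$ (i, 0)) xs) * prod_list (map (\<lambda>i. T $$ (0, \<sigma> i)) xs)"
    if "\<And>i. i < n \<Longrightarrow> \<sigma> i < n" for \<sigma>
  proof -
    have "map (\<lambda>i. T $$ (i, \<sigma> i)) xs = map (\<lambda>i. T $$ (i, 0) * T $$ (0, \<sigma> i)) xs"
      using set that by (auto simp: tr)
    then have "prod_list (map (\<lambda>i. T $$ (i, \<sigma> i)) xs) =
        prod_list (map (\<lambda>i. T $$ (i, 0) * T $$ (0, \<sigma> i)) xs)" by (rule arg_cong)
    also have "\<dots> = prod_list (map (\<lambda>i. T $$ (i, 0)) xs) * prod_list (map (\<lambda>i. T $$ (0, \<sigma> i)) xs)"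
      by (rule prod_list_mult_central) (use set c False in auto)
    finally show ?thesis .
  qed
  have "mset (map \<pi> xs) = mset xs"
    using set permutes_image[OF \<pi>] permutes_inj_on[OF \<pi>]
    by (intro set_eq_iff_mset_eq_distinct[THEN iffD1]) (auto simp: distinct_map)
  then have "mset (map (\<lambda>i. T $$ (0, i)) (map \<pi> xs)) = mset (map (\<lambda>i. T $$ (0, i)) xs)"
    by (metis mset_map)
  then have "prod_list (map (\<lambda>i. T $$ (0, i)) (map \<pi> xs)) = prod_list (map (\<lambda>i. T $$ (0, i)) xs)"
    by (rule prod_list_central_permute) (use set c \<pi>_less False in auto)
  then have "prod_list (map (\<lambda>i. T $$ (i, \<pi> i)) xs) = prod_list (map (\<lambda>i. T $$ (i, i)) xs)"
    using mult[of \<pi>] mult[of "\<lambda>i. i"] \<pi>_less by (simp add: comp_def)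
  also have "map (\<lambda>i. T $$ (i, i)) xs = map (\<lambda>_. 1) xs"
    using T set by (auto simp: transitive_mat_def)
  also have "prod_list (map (\<lambda>_. 1) xs) = (1::'a)" by (induction xs) auto
  finally show ?thesis .
qed

text \<open>Putting \<open>s\<close> in front of \<open>xs\<close> gives an ordering of all indices.
  The product is thus a right inverse of \<open>T $$ (s, \<pi> s)\<close>, whose left inverse is
  \<open>T $$ (\<pi> s, s)\<close>; the two agree.\<close>

lemma transitive_mat_prod_permutation_omit:
  assumes T: "transitive_mat n T" and cen: "elements_mat T \<subseteq> ring_center"
    and s: "s < n" and xs: "xs \<in> permutations_of_set ({..<n} - {s})"
    and \<pi>: "\<pi> permutes {..<n}"
  shows "prod_list (map (\<lambda>i. T $$ (i, \<pi> i)) xs) = T $$ (\<pi> s, s)"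
proof -
  have "s # xs \<in> permutations_of_set {..<n}"
    using xs s by (auto simp: permutations_of_set_def)
  from transitive_mat_prod_permutation[OF T cen this \<pi>]
  have 1: "T $$ (s, \<pi> s) * prod_list (map (\<lambda>i. T $$ (i, \<pi> i)) xs) = 1" by simp
  have "T $$ (\<pi> s, s) * T $$ (s, \<pi> s) = 1"
    using T s permutes_in_image[OF \<pi>, of s] by (simp add: transitive_mat_def)
  then have "prod_list (map (\<lambda>i. T $$ (i, \<pi> i)) xs) =
      T $$ (\<pi> s, s) * T $$ (s, \<pi> s) * prod_list (map (\<lambda>i. T $$ (i, \<pi> i)) xs)" by simp
  also have "\<dots> = T $$ (\<pi> s, s)" by (simp only: mult.assoc 1 mult_1_right)
  finally show ?thesis .
qed

section \<open>From permutations of the indices to orderings of them\<close>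

lemma bij_betw_permutes_permutations_of_set:
  assumes "distinct xs"
  shows "bij_betw (\<lambda>\<tau>. map \<tau> xs) {\<tau>. \<tau> permutes set xs} (permutations_of_set (set xs))"
proof -
  have inj: "inj_on (\<lambda>\<tau>. map \<tau> xs) {\<tau>. \<tau> permutes set xs}"
  proof (rule inj_onI, rule ext)
    fix \<sigma> \<tau> x
    assume "\<sigma> \<in> {\<tau>. \<tau> permutes set xs}" "\<tau> \<in> {\<tau>. \<tau> permutes set xs}" "map \<sigma> xs = map \<tau> xs"
    then show "\<sigma> x = \<tau> x"
      by (cases "x \<in> set xs") (auto simp: permutes_not_in)
  qed
  have sub: "(\<lambda>\<tau>. map \<tau> xs) ` {\<tau>. \<tau> permutes set xs} \<subseteq> permutations_of_set (set xs)"
  proof (rule image_subsetI)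
    fix \<tau> assume "\<tau> \<in> {\<tau>. \<tau> permutes set xs}"
    then have "\<tau> ` set xs = set xs" "inj_on \<tau> (set xs)"
      by (auto simp only: mem_Collect_eq permutes_image permutes_inj_on)
    with assms show "map \<tau> xs \<in> permutations_of_set (set xs)"
      by (simp add: permutations_of_set_def distinct_map)
  qed
  \<comment> \<open>Surjectivity by counting: the image and the target both have
    \<open>fact (card (set xs))\<close> elements.\<close>
  have "card ((\<lambda>\<tau>. map \<tau> xs) ` {\<tau>. \<tau> permutes set xs}) = card (permutations_of_set (set xs))"
    by (simp add: card_image[OF inj] card_permutations)
  with sub have "(\<lambda>\<tau>. map \<tau> xs) ` {\<tau>. \<tau> permutes set xs} = permutations_of_set (set xs)"
    by (intro card_subset_eq) auto
  with inj show ?thesis by (simp add: bij_betw_def)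
qed

text \<open>The products in \<open>sdet\<close> and \<open>preadjoint\<close> see
  \<open>\<tau>\<close> only through its list of values. Summing over such lists allows a first or
  last index to be split off.\<close>

lemma sum_permutes_map:
  "distinct xs \<Longrightarrow>
    (\<Sum>\<tau> | \<tau> permutes set xs. g (map \<tau> xs)) = (\<Sum>ys\<in>permutations_of_set (set xs). g ys)"
  using sum.reindex_bij_betw[OF bij_betw_permutes_permutations_of_set] by blast

lemma permutes_fixing_eq:
  assumes "s \<in> S"
  shows "{\<tau>. \<tau> permutes S \<and> \<tau> s = s} = {\<tau>. \<tau> permutes (S - {s})}"
  by (auto intro: permutes_superset permutes_subset simp: permutes_not_in)

lemma sdet_eq_sum_permutations_of_set:
  assumes "A \<in> carrier_mat n n"
  shows "sdet A = (\<Sum>xs\<in>permutations_of_set {..<n}. \<Sum>\<pi> | \<pi> permutes {..<n}.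
    perm_sgn \<pi> * prod_list (map (\<lambda>i. A $$ (i, \<pi> i)) xs))"
  using assms sum_permutes_map[of "[0..<n]"
    "\<lambda>xs. \<Sum>\<pi> | \<pi> permutes {..<n}. perm_sgn \<pi> * prod_list (map (\<lambda>i. A $$ (i, \<pi> i)) xs)"]
  by (simp add: sdet_def comp_def atLeast0LessThan)

text \<open>The permutations \<open>\<tau>\<close> fixing \<open>s\<close> are those of the other
  indices, so they correspond to orderings of \<open>{..<n} - {s}\<close>.\<close>

lemma preadjoint_index:
  assumes "A \<in> carrier_mat n n" and "r < n" and "s < n"
  shows "preadjoint A $$ (r, s) =
    (\<Sum>xs\<in>permutations_of_set ({..<n} - {s}). \<Sum>\<pi> | \<pi> permutes {..<n} \<and> \<pi> s = r.
      perm_sgn \<pi> * prod_list (map (\<lambda>i. A $$ (i, \<pi> i)) xs))"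
proof -
  have "set (filter (\<lambda>i. i \<noteq> s) [0..<n]) = {..<n} - {s}" by auto
  then show ?thesis
    using assms permutes_fixing_eq[of s "{..<n}"]
      sum_permutes_map[of "filter (\<lambda>i. i \<noteq> s) [0..<n]" "\<lambda>xs. \<Sum>\<pi> | \<pi> permutes {..<n} \<and> \<pi> s = r.
        perm_sgn \<pi> * prod_list (map (\<lambda>i. A $$ (i, \<pi> i)) xs)"]
    by (simp add: preadjoint_def comp_def)
qed

section \<open>The symmetric determinant as a trace\<close>

lemma preadjoint_carrier: "A \<in> carrier_mat n n \<Longrightarrow> preadjoint A \<in> carrier_mat n n"
  by (simp add: preadjoint_def Let_def)

lemma mult_perm_sgn_left: "x * (perm_sgn \<pi> * y) = perm_sgn \<pi> * (x * y)"
  by (simp add: perm_sgn_def)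

lemma mat_trace_mult:
  assumes "A \<in> carrier_mat n n" and "B \<in> carrier_mat n n"
  shows "mat_trace (A * B) = (\<Sum>i<n. \<Sum>j<n. A $$ (i, j) * B $$ (j, i))"
  using assms by (simp add: mat_trace_def scalar_prod_def atLeast0LessThan)

text \<open>In the traces below, this merges the sum over the row index \<open>r\<close> of the
  preadjoint with the sum over \<open>\<pi>\<close> subject to \<open>\<pi> s = r\<close>.\<close>

lemma sum_permutes_by_value:
  assumes "finite S" and "s \<in> S"
  shows "(\<Sum>r\<in>S. \<Sum>\<pi> | \<pi> permutes S \<and> \<pi> s = r. g \<pi>) = (\<Sum>\<pi> | \<pi> permutes S. g \<pi>)"
proof -
  have "(\<lambda>\<pi>. \<pi> s) ` {\<pi>. \<pi> permutes S} \<subseteq> S"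
    using assms by (auto dest: permutes_in_image[of _ _ s])
  from sum.group[OF finite_permutations[OF assms(1)] assms(1) this, of g] show ?thesis
    by simp
qed

lemma sum_permutations_of_set_Cons:
  assumes "finite S" and "S \<noteq> {}"
  shows "(\<Sum>xs\<in>permutations_of_set S. f xs) =
    (\<Sum>s\<in>S. \<Sum>xs\<in>permutations_of_set (S - {s}). f (s # xs))"
proof -
  have "(\<Sum>xs\<in>permutations_of_set S. f xs) =
      (\<Sum>s\<in>S. \<Sum>xs\<in>(#) s ` permutations_of_set (S - {s}). f xs)"
    unfolding permutations_of_set_nonempty[OF assms(2)]
    using assms(1) by (intro sum.UNION_disjoint) auto
  also have "\<dots> = (\<Sum>s\<in>S. \<Sum>xs\<in>permutations_of_set (S - {s}). f (s # xs))"
    by (simp add: sum.reindex)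
  finally show ?thesis .
qed

lemma sdet_eq_trace_mult_preadjoint:
  assumes A: "A \<in> carrier_mat n n" and n: "n \<ge> 1"
  shows "sdet A = mat_trace (A * preadjoint A)"
proof -
  let ?g = "\<lambda>xs \<pi>. perm_sgn \<pi> * prod_list (map (\<lambda>i. A $$ (i, \<pi> i)) xs)"
  let ?P = "\<lambda>s. permutations_of_set ({..<n} - {s})"
  have "mat_trace (A * preadjoint A) = (\<Sum>s<n. \<Sum>r<n. A $$ (s, r) *
      (\<Sum>xs\<in>?P s. \<Sum>\<pi> | \<pi> permutes {..<n} \<and> \<pi> s = r. ?g xs \<pi>))"
    by (simp add: mat_trace_mult[OF A preadjoint_carrier[OF A]] preadjoint_index[OF A])
  \<comment> \<open>Since \<open>r = \<pi> s\<close>, the entry of \<open>A\<close> in front is the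
    factor belonging to the new head \<open>s\<close> of the ordering.\<close>
  also have "\<dots> = (\<Sum>s<n. \<Sum>r<n. \<Sum>xs\<in>?P s. \<Sum>\<pi> | \<pi> permutes {..<n} \<and> \<pi> s = r. ?g (s # xs) \<pi>)"
    by (simp add: sum_distrib_left mult_perm_sgn_left)
  also have "\<dots> = (\<Sum>s<n. \<Sum>xs\<in>?P s. \<Sum>r<n. \<Sum>\<pi> | \<pi> permutes {..<n} \<and> \<pi> s = r. ?g (s # xs) \<pi>)"
    by (intro sum.cong refl sum.swap)
  also have "\<dots> = (\<Sum>s<n. \<Sum>xs\<in>?P s. \<Sum>\<pi> | \<pi> permutes {..<n}. ?g (s # xs) \<pi>)"
    by (intro sum.cong refl sum_permutes_by_value) simp_all
  also have "\<dots> = (\<Sum>xs\<in>permutations_of_set {..<n}. \<Sum>\<pi> | \<pi> permutes {..<n}. ?g xs \<pi>)"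
    by (rule sum_permutations_of_set_Cons[symmetric]) (use n in \<open>auto simp: lessThan_empty_iff\<close>)
  finally show ?thesis using sdet_eq_sum_permutations_of_set[OF A] by simp
qed

lemma sum_permutations_of_set_rev:
  "(\<Sum>xs\<in>permutations_of_set S. f (rev xs)) = (\<Sum>xs\<in>permutations_of_set S. f xs)"
  by (rule sum.reindex_bij_witness[of _ rev rev]) (auto simp: permutations_of_set_def)

text \<open>Here the entry of \<open>A\<close> stands on the right, so \<open>s\<close> becomes the
  last index of the ordering; reversing the orderings reduces this to splitting off a first
  index.\<close>

lemma sdet_eq_trace_preadjoint_mult:
  assumes A: "A \<in> carrier_mat n n" and n: "n \<ge> 1"
  shows "sdet A = mat_trace (preadjoint A * A)"
proof -
  let ?g = "\<lambda>xs \<pi>. perm_sgn \<pi> * prod_list (map (\<lambda>i. A $$ (i, \<pi> i)) xs)"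
  let ?P = "\<lambda>s. permutations_of_set ({..<n} - {s})"
  have "mat_trace (preadjoint A * A) = (\<Sum>r<n. \<Sum>s<n.
      (\<Sum>xs\<in>?P s. \<Sum>\<pi> | \<pi> permutes {..<n} \<and> \<pi> s = r. ?g xs \<pi>) * A $$ (s, r))"
    by (simp add: mat_trace_mult[OF preadjoint_carrier[OF A] A] preadjoint_index[OF A])
  also have "\<dots> = (\<Sum>r<n. \<Sum>s<n. \<Sum>xs\<in>?P s. \<Sum>\<pi> | \<pi> permutes {..<n} \<and> \<pi> s = r. ?g (xs @ [s]) \<pi>)"
    by (simp add: sum_distrib_right mult.assoc)
  also have "\<dots> = (\<Sum>s<n. \<Sum>r<n. \<Sum>xs\<in>?P s. \<Sum>\<pi> | \<pi> permutes {..<n} \<and> \<pi> s = r. ?g (xs @ [s]) \<pi>)"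
    by (rule sum.swap)
  also have "\<dots> = (\<Sum>s<n. \<Sum>xs\<in>?P s. \<Sum>r<n. \<Sum>\<pi> | \<pi> permutes {..<n} \<and> \<pi> s = r. ?g (xs @ [s]) \<pi>)"
    by (intro sum.cong refl sum.swap)
  also have "\<dots> = (\<Sum>s<n. \<Sum>xs\<in>?P s. \<Sum>\<pi> | \<pi> permutes {..<n}. ?g (xs @ [s]) \<pi>)"
    by (intro sum.cong refl sum_permutes_by_value) simp_all
  \<comment> \<open>Replacing \<open>xs\<close> by \<open>rev xs\<close> in the inner sum turns
    \<open>xs @ [s]\<close> into \<open>rev (s # xs)\<close>.\<close>
  also have "\<dots> = (\<Sum>s<n. \<Sum>xs\<in>?P s. \<Sum>\<pi> | \<pi> permutes {..<n}. ?g (rev (s # xs)) \<pi>)"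
    by (subst sum_permutations_of_set_rev[symmetric]) simp
  also have "\<dots> = (\<Sum>xs\<in>permutations_of_set {..<n}. \<Sum>\<pi> | \<pi> permutes {..<n}. ?g (rev xs) \<pi>)"
    by (rule sum_permutations_of_set_Cons[symmetric]) (use n in \<open>auto simp: lessThan_empty_iff\<close>)
  also have "\<dots> = (\<Sum>xs\<in>permutations_of_set {..<n}. \<Sum>\<pi> | \<pi> permutes {..<n}. ?g xs \<pi>)"
    by (rule sum_permutations_of_set_rev)
  finally show ?thesis using sdet_eq_sum_permutations_of_set[OF A] by simp
qed

section \<open>Endomorphisms and closure properties of the supermatrix algebra\<close>

lemma ring_endomorphism_zero: "ring_endomorphism \<delta> \<Longrightarrow> \<delta> 0 = 0"
  unfolding ring_endomorphism_def by (metis add_cancel_right_right)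

lemma ring_endomorphism_uminus: "ring_endomorphism \<delta> \<Longrightarrow> \<delta> (- x) = - \<delta> x"
  by (metis add.right_inverse minus_unique ring_endomorphism_def ring_endomorphism_zero)

lemma ring_endomorphism_sum: "ring_endomorphism \<delta> \<Longrightarrow> \<delta> (\<Sum>x\<in>S. f x) = (\<Sum>x\<in>S. \<delta> (f x))"
  by (induction S rule: infinite_finite_induct)
    (auto simp: ring_endomorphism_zero, simp add: ring_endomorphism_def)

lemma ring_endomorphism_perm_sgn: "ring_endomorphism \<delta> \<Longrightarrow> \<delta> (perm_sgn \<pi>) = perm_sgn \<pi>"
  by (simp add: perm_sgn_def ring_endomorphism_uminus) (simp add: ring_endomorphism_def)

lemma ring_endomorphism_prod_list:
  "ring_endomorphism \<delta> \<Longrightarrow> \<delta> (prod_list xs) = prod_list (map \<delta> xs)"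
  by (induction xs) (auto simp: ring_endomorphism_def)

text \<open>In the \<open>l\<close>-th term of an entry, the scalar from \<open>B\<close> moves past
  the entry of \<open>A\<close> by centrality and meets the scalar from \<open>A\<close>.
  Transitivity makes their product \<open>T $$ (i, j)\<close>, the same for every
  \<open>l\<close>.\<close>

lemma supermatrix_algebra_mult:
  assumes \<delta>: "ring_endomorphism \<delta>" and T: "transitive_mat n T"
    and cen: "elements_mat T \<subseteq> ring_center"
    and A: "A \<in> supermatrix_algebra n \<delta> T" and B: "B \<in> supermatrix_algebra n \<delta> T"
  shows "A * B \<in> supermatrix_algebra n \<delta> T"
proof -
  have carr: "A \<in> carrier_mat n n" "B \<in> carrier_mat n n"
    using A B by (auto simp: supermatrix_algebra_def)
  note c = transitive_mat_entry_central[OF T cen]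
  have AB: "(A * B) $$ (i, j) = (\<Sum>l<n. A $$ (i, l) * B $$ (l, j))" if "i < n" "j < n" for i j
    using carr that by (simp add: scalar_prod_def atLeast0LessThan)
  have "\<delta> ((A * B) $$ (i, j)) = T $$ (i, j) * (A * B) $$ (i, j)" if ij: "i < n" "j < n" for i j
  proof -
    have "\<delta> (A $$ (i, l) * B $$ (l, j)) = T $$ (i, j) * (A $$ (i, l) * B $$ (l, j))"
      if l: "l < n" for l
    proof -
      have "\<delta> (A $$ (i, l) * B $$ (l, j)) =
          T $$ (i, l) * (A $$ (i, l) * T $$ (l, j)) * B $$ (l, j)"
        using A B \<delta> ij l by (simp add: supermatrix_algebra_def ring_endomorphism_def mult.assoc)
      also have "A $$ (i, l) * T $$ (l, j) = T $$ (l, j) * A $$ (i, l)"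
        using c[OF l ij(2)] by (simp add: ring_center_commute)
      also have "T $$ (i, l) * (T $$ (l, j) * A $$ (i, l)) = T $$ (i, j) * A $$ (i, l)"
        using T ij l by (simp add: transitive_mat_def mult.assoc[symmetric])
      finally show ?thesis by (simp add: mult.assoc)
    qed
    then show ?thesis
      by (simp add: AB ij ring_endomorphism_sum[OF \<delta>] sum_distrib_left)
  qed
  then show ?thesis using carr by (simp add: supermatrix_algebra_def)
qed

text \<open>Every summand of the \<open>(r, s)\<close> entry omits \<open>s\<close> and has
  \<open>\<pi> s = r\<close>, so all of them are scaled by the same factor
  \<open>T $$ (r, s)\<close>.\<close>

lemma supermatrix_algebra_preadjoint:
  assumes \<delta>: "ring_endomorphism \<delta>" and T: "transitive_mat n T"
    and cen: "elements_mat T \<subseteq> ring_center"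
    and A: "A \<in> supermatrix_algebra n \<delta> T"
  shows "preadjoint A \<in> supermatrix_algebra n \<delta> T"
proof -
  have carr: "A \<in> carrier_mat n n" using A by (auto simp: supermatrix_algebra_def)
  note c = transitive_mat_entry_central[OF T cen]
  have "\<delta> (preadjoint A $$ (r, s)) = T $$ (r, s) * preadjoint A $$ (r, s)"
    if rs: "r < n" "s < n" for r s
  proof -
    have *: "\<delta> (perm_sgn \<pi> * prod_list (map (\<lambda>i. A $$ (i, \<pi> i)) xs)) =
        T $$ (r, s) * (perm_sgn \<pi> * prod_list (map (\<lambda>i. A $$ (i, \<pi> i)) xs))"
      if xs: "xs \<in> permutations_of_set ({..<n} - {s})"
        and \<pi>: "\<pi> permutes {..<n}" "\<pi> s = r" for xs \<pi>
    proof -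
      have i: "i < n \<and> \<pi> i < n" if "i \<in> set xs" for i
        using that xs permutes_in_image[OF \<pi>(1), of i] by (auto simp: permutations_of_set_def)
      have "\<delta> (prod_list (map (\<lambda>i. A $$ (i, \<pi> i)) xs)) =
          prod_list (map (\<lambda>i. \<delta> (A $$ (i, \<pi> i))) xs)"
        by (simp add: ring_endomorphism_prod_list[OF \<delta>] comp_def)
      also have "map (\<lambda>i. \<delta> (A $$ (i, \<pi> i))) xs =
          map (\<lambda>i. T $$ (i, \<pi> i) * A $$ (i, \<pi> i)) xs"
        using A i by (simp add: supermatrix_algebra_def)
      also have "prod_list \<dots> = T $$ (r, s) * prod_list (map (\<lambda>i. A $$ (i, \<pi> i)) xs)"
        using transitive_mat_prod_permutation_omit[OF T cen rs(2) xs \<pi>(1)] \<pi>(2) c i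
        by (simp add: prod_list_mult_central)
      \<comment> \<open>The sign is 1 or -1, so \<open>\<delta>\<close> fixes it and
        \<open>T $$ (r, s)\<close> moves past it.\<close>
      finally show ?thesis
        using \<delta> by (simp add: mult_perm_sgn_left ring_endomorphism_perm_sgn[OF \<delta>])
          (simp add: ring_endomorphism_def ring_endomorphism_perm_sgn[OF \<delta>])
    qed
    show ?thesis
      unfolding preadjoint_index[OF carr rs] ring_endomorphism_sum[OF \<delta>] sum_distrib_left
      by (intro sum.cong refl *) auto
  qed
  then show ?thesis using preadjoint_carrier[OF carr] by (simp add: supermatrix_algebra_def)
qed

section \<open>Traces and the adjoint sequences\<close>

lemma mat_trace_in_Fix:
  assumes \<delta>: "ring_endomorphism \<delta>" and T: "transitive_mat n T"
    and A: "A \<in> supermatrix_algebra n \<delta> T"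
  shows "mat_trace A \<in> Fix \<delta>"
proof -
  have "\<delta> (A $$ (i, i)) = A $$ (i, i)" if "i < dim_row A" for i
    using A T that by (auto simp: supermatrix_algebra_def transitive_mat_def)
  then show ?thesis by (simp add: Fix_def mat_trace_def ring_endomorphism_sum[OF \<delta>])
qed

text \<open>The induction alternates the two closure properties: the preadjoint of the current
  partial product is the next factor, and multiplying by it gives the next partial product. At
  \<open>k = 0\<close> the fold is over the empty list and returns \<open>A\<close>.\<close>

lemma supermatrix_algebra_right_products:
  assumes "ring_endomorphism \<delta>" and "transitive_mat n T"
    and "elements_mat T \<subseteq> ring_center" and "A \<in> supermatrix_algebra n \<delta> T"
  shows "foldl (\<lambda>M P. M * P) A (map (right_adjoint_seq A) [1..<Suc k]) \<in> supermatrix_algebra n \<delta> T"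
proof (induction k)
  case 0
  show ?case using assms by simp
next
  case (Suc k)
  then have "right_adjoint_seq A (Suc k) \<in> supermatrix_algebra n \<delta> T"
    unfolding right_adjoint_seq_Suc using assms by (intro supermatrix_algebra_preadjoint)
  with Suc show ?case using assms by (simp add: supermatrix_algebra_mult)
qed

lemma supermatrix_algebra_left_products:
  assumes "ring_endomorphism \<delta>" and "transitive_mat n T"
    and "elements_mat T \<subseteq> ring_center" and "A \<in> supermatrix_algebra n \<delta> T"
  shows "foldl (\<lambda>M Q. Q * M) A (map (left_adjoint_seq A) [1..<Suc k]) \<in> supermatrix_algebra n \<delta> T"
proof (induction k)
  case 0
  show ?case using assms by simp
next
  case (Suc k)
  then have "left_adjoint_seq A (Suc k) \<in> supermatrix_algebra n \<delta> T"
    unfolding left_adjoint_seq_Suc using assms by (intro supermatrix_algebra_preadjoint)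
  with Suc show ?case using assms by (simp add: supermatrix_algebra_mult)
qed

theorem corollary4p2:
  fixes n :: nat
    and \<delta> :: "'a::{ring,monoid_mult} \<Rightarrow> 'a"
    and T A :: "'a mat"
  assumes "n \<ge> 1"
    and "ring_endomorphism \<delta>"
    and "transitive_mat n T"
    and "elements_mat T \<subseteq> ring_center"
    and "A \<in> supermatrix_algebra n \<delta> T"
  shows "(\<forall>k\<ge>1. rdet k A \<in> Fix \<delta> \<and> ldet k A \<in> Fix \<delta>) \<and>
         sdet A = rdet 1 A \<and> rdet 1 A = ldet 1 A \<and> sdet A \<in> Fix \<delta>"
proof -
  have carr: "A \<in> carrier_mat n n" using assms(5) by (simp add: supermatrix_algebra_def)
  have "rdet k A \<in> Fix \<delta>" "ldet k A \<in> Fix \<delta>" for k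
    unfolding rdet_def ldet_def
    using mat_trace_in_Fix[OF assms(2,3)] supermatrix_algebra_right_products[OF assms(2-5)]
      supermatrix_algebra_left_products[OF assms(2-5)] by blast+
  \<comment> \<open>For \<open>k = 1\<close> the fold has a single step, so its value is
    \<open>A * preadjoint A\<close>.\<close>
  moreover have "rdet 1 A = sdet A"
    using sdet_eq_trace_mult_preadjoint[OF carr assms(1)] right_adjoint_seq_1[of A]
    by (simp add: rdet_def)
  moreover have "ldet 1 A = sdet A"
    using sdet_eq_trace_preadjoint_mult[OF carr assms(1)] left_adjoint_seq_1[of A]
    by (simp add: ldet_def)
  ultimately show ?thesis by metis
qed

end
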